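(* Let $S$ be a scalar field and let $k$ be a category (of generalized linear maps over $S$). For objects $a,b$ with dot product and $f\in\mathrm{Cont}_k^S(a,b)$, i.e. a function $f:k(b,S)\to k(a,S)$, let $\mathrm{asDual}\,f=\mathrm{Dual}(\mathrm{dot}^{-1}\circ f\circ\mathrm{dot})\in\mathrm{Dual}_k(a,b)$. Then, with the operations on $\mathrm{Cont}_k^S$ and $\mathrm{Dual}_k$ defined in the context, $\mathrm{asDual}$ is a homomorphism with respect to each of the classes Category, Monoidal, Cartesian, Cocartesian and Scalable for which $\mathrm{Dual}_k$ is given operations. That is, for all $f,g$ in $\mathrm{Cont}_k^S$ of suitable types: (i) (Category) $\mathrm{asDual}\,\mathrm{id}=\mathrm{id}$ and $\mathrm{asDual}(g\circ f)=\mathrm{asDual}\,g\circ\mathrm{asDual}\,f$; (ii) (Monoidal) if $k$ is Monoidal, $\mathrm{asDual}(f\times g)=\mathrm{asDual}\,f\times\mathrm{asDual}\,g$; (iii) (Cartesian) if $k$ is Cartesian, $\mathrm{asDual}\,\mathrm{exl}=\mathrm{exl}$, $\mathrm{asDual}\,\mathrm{exr}=\mathrm{exr}$, $\mathrm{asDual}\,\mathrm{dup}=\mathrm{dup}$; (iv) (Cocartesian) if $k$ is Cocartesian, $\mathrm{asDual}\,\mathrm{inl}=\mathrm{inl}$, $\mathrm{asDual}\,\mathrm{inr}=\mathrm{inr}$, $\mathrm{asDual}\,\mathrm{jam}=\mathrm{jam}$; (v) (Scalable) if $k$ is Scalable, $\mathrm{asDual}(\mathrm{scale}\,c)=\mathrm{scale}\,c$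 for all scalars $c$. In each equation the operations inside the argument of $\mathrm{asDual}$ are those of $\mathrm{Cont}_k^S$, and the other ones are those of $\mathrm{Dual}_k$. In (ii)–(iv) products and coproducts in $k$ coincide (they are biproducts).
   Context: Objects of $k$ are vector spaces over $S$, and $k(u,v)$ denotes the morphisms from $u$ to $v$, which play the role of the linear maps $u\multimap v$. In particular $k(u,S)$ plays the role of the dual space $u\multimap S$, and a function $b\to a$ obtained below is regarded as the morphism in $k(b,a)$ that it represents. An object $u$ has a dot product if it comes with a curried dot product $\mathrm{dot}:u\to k(u,S)$ (the curried form of a bilinear map $u\times u\to S$) that is an isomorphism, with inverse $\mathrm{dot}^{-1}$. On the scalars $\mathrm{dot}=\mathrm{scale}$, i.e. $\mathrm{dot}\,x$ is $y\mapsto xy$; on a product, $\mathrm{dot}(u,v)=\mathrm{dot}\,u\mathbin{\triangledown}\mathrm{dot}\,v$, i.e. $(x,y)\mapsto\mathrm{dot}\,u\,x+\mathrm{dot}\,v\,y$. Classes of structure on $k$: - Monoidal: $f\times g\in k(a\times b,c\times d)$ for $f\in k(a,c)$, $g\in k(b,d)$ (for functions, $(x,y)\mapsto(f\,x,g\,y)$). - Cartesian: Monoidal with $\mathrm{exl}\in k(a\times b,a)$, $\mathrm{exr}\in k(a\times b,b)$, $\mathrm{dup}\in k(a,a\times a)$ (for functions, $(x,y)\mapsto x$, $(x,y)\mapsto y$, $x\mapsto(x,x)$). - Cocartesian: $\mathrm{inl}\in k(a,a\times b)$, $\mathrm{inr}\in k(b,a\times b)$, $\mathrm{jam}\in k(a\times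 a,a)$ (for functions, $x\mapsto(x,0)$, $y\mapsto(0,y)$, $(x,y)\mapsto x+y$). - Scalable: morphisms $\mathrm{scale}\,c\in k(a,a)$ (for functions, $x\mapsto c\cdot x$). For $p\in k(c,a)$, $q\in k(d,a)$ put $p\mathbin{\triangledown}q=\mathrm{jam}\circ(p\times q)\in k(c\times d,a)$. Define the mutually inverse functions $\mathrm{join}(p,q)=p\mathbin{\triangledown}q$ and $\mathrm{unjoin}\,h=(h\circ\mathrm{inl},h\circ\mathrm{inr})$ for $h\in k(c\times d,a)$. Hom-sets have addition $f+g=\mathrm{jam}\circ(f\times g)\circ\mathrm{dup}$ and zero $0$ (the morphism factoring through the zero object). $\mathrm{Cont}_k^S(a,b)$ is the set of functions $k(b,S)\to k(a,S)$, regarded as morphisms from $a$ to $b$, with operations: $\mathrm{id}$ is the identity function; the composite $G\circ F$ (for $F\in\mathrm{Cont}_k^S(a,b)$, $G\in\mathrm{Cont}_k^S(b,c)$) is $h\mapsto F(G(h))$; $F\times G$ is $\mathrm{join}\circ(F\times G)\circ\mathrm{unjoin}$ (inner $\times$ acting componentwise on pairs); $\mathrm{exl}$ is $h\mapsto\mathrm{join}(h,0)$; $\mathrm{exr}$ is $h\mapsto\mathrm{join}(0,h)$; $\mathrm{dup}$ is $h\mapsto h_1+h_2$ with $(h_1,h_2)=\mathrm{unjoin}\,h$; $\mathrm{inl}$ and $\mathrm{inr}$ are $h\mapsto$ the first, respectively second, component of $\mathrm{unjoin}\,h$; $\mathrm{jam}$ is $h\mapsto\mathrm{join}(h,h)$;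 $\mathrm{scale}\,c$ is scalar multiplication by $c$ on $k(a,S)$, $h\mapsto\mathrm{scale}\,c\circ h$. $\mathrm{Dual}_k(a,b)$ consists of the morphisms $\mathrm{Dual}\,f$ with $f\in k(b,a)$, regarded as morphisms from $a$ to $b$, with operations: $\mathrm{id}=\mathrm{Dual}\,\mathrm{id}$; $\mathrm{Dual}\,g\circ\mathrm{Dual}\,f=\mathrm{Dual}(f\circ g)$; $\mathrm{Dual}\,f\times\mathrm{Dual}\,g=\mathrm{Dual}(f\times g)$; $\mathrm{exl}=\mathrm{Dual}\,\mathrm{inl}$; $\mathrm{exr}=\mathrm{Dual}\,\mathrm{inr}$; $\mathrm{dup}=\mathrm{Dual}\,\mathrm{jam}$; $\mathrm{inl}=\mathrm{Dual}\,\mathrm{exl}$; $\mathrm{inr}=\mathrm{Dual}\,\mathrm{exr}$; $\mathrm{jam}=\mathrm{Dual}\,\mathrm{dup}$; $\mathrm{scale}\,c=\mathrm{Dual}(\mathrm{scale}\,c)$. On the right-hand sides the operations are those of $k$.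
   Formalization: Since dot⁻¹∘f∘dot need not represent a morphism of k for an arbitrary function f in Cont (e.g. when it is x ↦ x²), f and g range over those functions for which it does, i.e. for which asDual is defined. *)

theory Defs
  imports "HOL-Algebra.Module" "HOL-Library.FuncSet"
begin

text \<open>
  All vector spaces and the scalar field have their elements in one universe \<open>'e\<close>. Objects are
  vector spaces in the sense of \<^theory>\<open>HOL-Algebra.Module\<close>, that is, modules over a field; the
  ring multiplication and unit that the record inherits play no role.
\<close>

type_synonym 'e vs = "('e, 'e) module"

definition scalar_space :: "'e ring \<Rightarrow> 'e vs" where
  "scalar_space S =
     \<lparr>carrier = carrier S, mult = mult S, one = one S, zero = zero S, add = add S,
      smult = mult S\<rparr>"

definition linear_map :: "'e ring \<Rightarrow> 'e vs \<Rightarrow> 'e vs \<Rightarrow> ('e \<Rightarrow> 'e) \<Rightarrow> bool" where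
  "linear_map S a b \<phi> \<longleftrightarrow>
     \<phi> \<in> carrier a \<rightarrow> carrier b \<and>
     (\<forall>x\<in>carrier a. \<forall>y\<in>carrier a. \<phi> (x \<oplus>\<^bsub>a\<^esub> y) = \<phi> x \<oplus>\<^bsub>b\<^esub> \<phi> y) \<and>
     (\<forall>c\<in>carrier S. \<forall>x\<in>carrier a. \<phi> (c \<odot>\<^bsub>a\<^esub> x) = c \<odot>\<^bsub>b\<^esub> \<phi> x)"

text \<open>
  The data of a category of generalized linear maps. The field \<open>fun_of\<close> gives the function that a
  morphism represents, \<open>pairing\<close> encodes pairs of elements of the universe, and \<open>Dots\<close> is the set
  of objects that come with a dot product. The fields from \<open>tensor\<close> to \<open>scale\<close> are meaningful only
  under the corresponding locale predicates below. Composition, \<open>tensor\<close> and \<open>fun_of\<close> do not take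
  the objects as arguments; if they depend on them, the morphisms can be tagged with domain and
  codomain.
\<close>

record ('e, 'm) lincat =
  Ob :: "'e vs set"
  Hom :: "'e vs \<Rightarrow> 'e vs \<Rightarrow> 'm set"
  ident :: "'e vs \<Rightarrow> 'm"
  compose :: "'m \<Rightarrow> 'm \<Rightarrow> 'm"  (infixr \<open>\<cdot>\<index>\<close> 65)
  fun_of :: "'m \<Rightarrow> 'e \<Rightarrow> 'e"
  pairing :: "'e \<times> 'e \<Rightarrow> 'e"
  tensor :: "'m \<Rightarrow> 'm \<Rightarrow> 'm"
  exl :: "'e vs \<Rightarrow> 'e vs \<Rightarrow> 'm"
  exr :: "'e vs \<Rightarrow> 'e vs \<Rightarrow> 'm"
  dup :: "'e vs \<Rightarrow> 'm"
  inl :: "'e vs \<Rightarrow> 'e vs \<Rightarrow> 'm"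
  inr :: "'e vs \<Rightarrow> 'e vs \<Rightarrow> 'm"
  jam :: "'e vs \<Rightarrow> 'm"
  scale :: "'e \<Rightarrow> 'e vs \<Rightarrow> 'm"
  Dots :: "'e vs set"
  dot :: "'e vs \<Rightarrow> 'e \<Rightarrow> 'm"

definition prod_space :: "('e, 'm) lincat \<Rightarrow> 'e vs \<Rightarrow> 'e vs \<Rightarrow> 'e vs" where
  "prod_space k a b =
     (let \<pi> = pairing k; p1 = (\<lambda>z. fst (inv_into UNIV \<pi> z)); p2 = (\<lambda>z. snd (inv_into UNIV \<pi> z)) in
      \<lparr>carrier = \<pi> ` (carrier a \<times> carrier b),
       mult = undefined, one = undefined,
       zero = \<pi> (\<zero>\<^bsub>a\<^esub>, \<zero>\<^bsub>b\<^esub>),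
       add = (\<lambda>z w. \<pi> (p1 z \<oplus>\<^bsub>a\<^esub> p1 w, p2 z \<oplus>\<^bsub>b\<^esub> p2 w)),
       smult = (\<lambda>c z. \<pi> (c \<odot>\<^bsub>a\<^esub> p1 z, c \<odot>\<^bsub>b\<^esub> p2 z))\<rparr>)"

text \<open>
  Faithfulness is what makes ``the morphism represented by a function'' meaningful. Together with
  the represented functions prescribed below, it yields all further laws: functoriality of
  \<open>tensor\<close>, the universal properties of the biproducts, and so on.
\<close>

locale linear_category = S: field S for S :: "'e ring" (structure) and k :: "('e, 'm) lincat" +
  assumes Ob_module: "a \<in> Ob k \<Longrightarrow> module S a"
    and scalar_Ob: "scalar_space S \<in> Ob k"
    and ident_Hom: "a \<in> Ob k \<Longrightarrow> ident k a \<in> Hom k a a"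
    and compose_Hom:
      "\<lbrakk>a \<in> Ob k; b \<in> Ob k; c \<in> Ob k; f \<in> Hom k a b; g \<in> Hom k b c\<rbrakk> \<Longrightarrow> g \<cdot>\<^bsub>k\<^esub> f \<in> Hom k a c"
    and ident_left: "\<lbrakk>a \<in> Ob k; b \<in> Ob k; f \<in> Hom k a b\<rbrakk> \<Longrightarrow> ident k b \<cdot>\<^bsub>k\<^esub> f = f"
    and ident_right: "\<lbrakk>a \<in> Ob k; b \<in> Ob k; f \<in> Hom k a b\<rbrakk> \<Longrightarrow> f \<cdot>\<^bsub>k\<^esub> ident k a = f"
    and compose_assoc:
      "\<lbrakk>a \<in> Ob k; b \<in> Ob k; c \<in> Ob k; d \<in> Ob k; f \<in> Hom k a b; g \<in> Hom k b c; h \<in> Hom k c d\<rbrakk>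
        \<Longrightarrow> (h \<cdot>\<^bsub>k\<^esub> g) \<cdot>\<^bsub>k\<^esub> f = h \<cdot>\<^bsub>k\<^esub> (g \<cdot>\<^bsub>k\<^esub> f)"
    and fun_of_linear:
      "\<lbrakk>a \<in> Ob k; b \<in> Ob k; f \<in> Hom k a b\<rbrakk> \<Longrightarrow> linear_map S a b (fun_of k f)"
    and fun_of_ident: "\<lbrakk>a \<in> Ob k; x \<in> carrier a\<rbrakk> \<Longrightarrow> fun_of k (ident k a) x = x"
    and fun_of_compose:
      "\<lbrakk>a \<in> Ob k; b \<in> Ob k; c \<in> Ob k; f \<in> Hom k a b; g \<in> Hom k b c; x \<in> carrier a\<rbrakk>
        \<Longrightarrow> fun_of k (g \<cdot>\<^bsub>k\<^esub> f) x = fun_of k g (fun_of k f x)"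
    and faithful:
      "\<lbrakk>a \<in> Ob k; b \<in> Ob k; f \<in> Hom k a b; g \<in> Hom k a b;
        \<And>x. x \<in> carrier a \<Longrightarrow> fun_of k f x = fun_of k g x\<rbrakk> \<Longrightarrow> f = g"

locale product_category = linear_category +
  assumes inj_pairing: "inj (pairing k)"
    and prod_Ob: "\<lbrakk>a \<in> Ob k; b \<in> Ob k\<rbrakk> \<Longrightarrow> prod_space k a b \<in> Ob k"

locale monoidal_category = product_category +
  assumes tensor_Hom:
      "\<lbrakk>a \<in> Ob k; b \<in> Ob k; c \<in> Ob k; d \<in> Ob k; f \<in> Hom k a c; g \<in> Hom k b d\<rbrakk>
        \<Longrightarrow> tensor k f g \<in> Hom k (prod_space k a b) (prod_space k c d)"
    and fun_of_tensor:
      "\<lbrakk>a \<in> Ob k; b \<in> Ob k; c \<in> Ob k; d \<in> Ob k; f \<in> Hom k a c; g \<in> Hom k b d;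
        x \<in> carrier a; y \<in> carrier b\<rbrakk>
        \<Longrightarrow> fun_of k (tensor k f g) (pairing k (x, y)) = pairing k (fun_of k f x, fun_of k g y)"

locale cartesian_category = monoidal_category +
  assumes exl_Hom: "\<lbrakk>a \<in> Ob k; b \<in> Ob k\<rbrakk> \<Longrightarrow> exl k a b \<in> Hom k (prod_space k a b) a"
    and exr_Hom: "\<lbrakk>a \<in> Ob k; b \<in> Ob k\<rbrakk> \<Longrightarrow> exr k a b \<in> Hom k (prod_space k a b) b"
    and dup_Hom: "a \<in> Ob k \<Longrightarrow> dup k a \<in> Hom k a (prod_space k a a)"
    and fun_of_exl:
      "\<lbrakk>a \<in> Ob k; b \<in> Ob k; x \<in> carrier a; y \<in> carrier b\<rbrakk>
        \<Longrightarrow> fun_of k (exl k a b) (pairing k (x, y)) = x"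
    and fun_of_exr:
      "\<lbrakk>a \<in> Ob k; b \<in> Ob k; x \<in> carrier a; y \<in> carrier b\<rbrakk>
        \<Longrightarrow> fun_of k (exr k a b) (pairing k (x, y)) = y"
    and fun_of_dup: "\<lbrakk>a \<in> Ob k; x \<in> carrier a\<rbrakk> \<Longrightarrow> fun_of k (dup k a) x = pairing k (x, x)"

locale cocartesian_category = product_category +
  assumes inl_Hom: "\<lbrakk>a \<in> Ob k; b \<in> Ob k\<rbrakk> \<Longrightarrow> inl k a b \<in> Hom k a (prod_space k a b)"
    and inr_Hom: "\<lbrakk>a \<in> Ob k; b \<in> Ob k\<rbrakk> \<Longrightarrow> inr k a b \<in> Hom k b (prod_space k a b)"
    and jam_Hom: "a \<in> Ob k \<Longrightarrow> jam k a \<in> Hom k (prod_space k a a) a"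
    and fun_of_inl:
      "\<lbrakk>a \<in> Ob k; b \<in> Ob k; x \<in> carrier a\<rbrakk>
        \<Longrightarrow> fun_of k (inl k a b) x = pairing k (x, \<zero>\<^bsub>b\<^esub>)"
    and fun_of_inr:
      "\<lbrakk>a \<in> Ob k; b \<in> Ob k; y \<in> carrier b\<rbrakk>
        \<Longrightarrow> fun_of k (inr k a b) y = pairing k (\<zero>\<^bsub>a\<^esub>, y)"
    and fun_of_jam:
      "\<lbrakk>a \<in> Ob k; x \<in> carrier a; y \<in> carrier a\<rbrakk>
        \<Longrightarrow> fun_of k (jam k a) (pairing k (x, y)) = x \<oplus>\<^bsub>a\<^esub> y"

locale scalable_category = linear_category +
  assumes scale_Hom: "\<lbrakk>c \<in> carrier S; a \<in> Ob k\<rbrakk> \<Longrightarrow> scale k c a \<in> Hom k a a"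
    and fun_of_scale:
      "\<lbrakk>c \<in> carrier S; a \<in> Ob k; x \<in> carrier a\<rbrakk> \<Longrightarrow> fun_of k (scale k c a) x = c \<odot>\<^bsub>a\<^esub> x"

definition zero_object :: "('e, 'm) lincat \<Rightarrow> 'e vs \<Rightarrow> bool" where
  "zero_object k z \<longleftrightarrow>
     z \<in> Ob k \<and> (\<forall>a\<in>Ob k. (\<exists>!p. p \<in> Hom k a z) \<and> (\<exists>!q. q \<in> Hom k z a))"

locale biproduct_category = cartesian_category + cocartesian_category +
  assumes ex_zero_object: "\<exists>z. zero_object k z"

definition zero_mor :: "('e, 'm) lincat \<Rightarrow> 'e vs \<Rightarrow> 'e vs \<Rightarrow> 'm" where
  "zero_mor k a b =
     (THE m. \<exists>z p q. zero_object k z \<and> p \<in> Hom k a z \<and> q \<in> Hom k z b \<and> m = q \<cdot>\<^bsub>k\<^esub> p)"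

text \<open>The argument \<open>a\<close> of \<open>join\<close> and \<open>add_mor\<close> is the (common) codomain of the morphisms.\<close>

definition join :: "('e, 'm) lincat \<Rightarrow> 'e vs \<Rightarrow> 'm \<times> 'm \<Rightarrow> 'm" where
  "join k a = (\<lambda>(p, q). jam k a \<cdot>\<^bsub>k\<^esub> tensor k p q)"

definition unjoin :: "('e, 'm) lincat \<Rightarrow> 'e vs \<Rightarrow> 'e vs \<Rightarrow> 'm \<Rightarrow> 'm \<times> 'm" where
  "unjoin k c d h = (h \<cdot>\<^bsub>k\<^esub> inl k c d, h \<cdot>\<^bsub>k\<^esub> inr k c d)"

definition add_mor :: "('e, 'm) lincat \<Rightarrow> 'e vs \<Rightarrow> 'e vs \<Rightarrow> 'm \<Rightarrow> 'm \<Rightarrow> 'm" where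
  "add_mor k b a f g = jam k a \<cdot>\<^bsub>k\<^esub> tensor k f g \<cdot>\<^bsub>k\<^esub> dup k b"

locale dot_category = linear_category +
  assumes Dots_Ob: "Dots k \<subseteq> Ob k"
    and dot_bij: "a \<in> Dots k \<Longrightarrow> bij_betw (dot k a) (carrier a) (Hom k a (scalar_space S))"
    and dot_add:
      "\<lbrakk>a \<in> Dots k; x \<in> carrier a; y \<in> carrier a; z \<in> carrier a\<rbrakk>
        \<Longrightarrow> fun_of k (dot k a (x \<oplus>\<^bsub>a\<^esub> y)) z = fun_of k (dot k a x) z \<oplus>\<^bsub>S\<^esub> fun_of k (dot k a y) z"
    and dot_smult:
      "\<lbrakk>a \<in> Dots k; c \<in> carrier S; x \<in> carrier a; z \<in> carrier a\<rbrakk>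
        \<Longrightarrow> fun_of k (dot k a (c \<odot>\<^bsub>a\<^esub> x)) z = c \<otimes>\<^bsub>S\<^esub> fun_of k (dot k a x) z"
    and scalar_Dots: "scalable_category S k \<Longrightarrow> scalar_space S \<in> Dots k"
    and dot_scalar:
      "\<lbrakk>scalable_category S k; x \<in> carrier S\<rbrakk>
        \<Longrightarrow> dot k (scalar_space S) x = scale k x (scalar_space S)"
    and prod_Dots:
      "\<lbrakk>biproduct_category S k; a \<in> Dots k; b \<in> Dots k\<rbrakk> \<Longrightarrow> prod_space k a b \<in> Dots k"
    and dot_prod:
      "\<lbrakk>biproduct_category S k; a \<in> Dots k; b \<in> Dots k; x \<in> carrier a; y \<in> carrier b\<rbrakk>
        \<Longrightarrow> dot k (prod_space k a b) (pairing k (x, y)) =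
            join k (scalar_space S) (dot k a x, dot k b y)"

text \<open>Continuations. Note the reversal: morphisms from \<open>a\<close> to \<open>b\<close> map \<open>k(b, S)\<close> to \<open>k(a, S)\<close>.\<close>

definition Cont :: "'e ring \<Rightarrow> ('e, 'm) lincat \<Rightarrow> 'e vs \<Rightarrow> 'e vs \<Rightarrow> ('m \<Rightarrow> 'm) set" where
  "Cont S k a b = Hom k b (scalar_space S) \<rightarrow> Hom k a (scalar_space S)"

definition cont_id :: "'m \<Rightarrow> 'm" where
  "cont_id = (\<lambda>h. h)"

definition cont_comp :: "('m \<Rightarrow> 'm) \<Rightarrow> ('m \<Rightarrow> 'm) \<Rightarrow> 'm \<Rightarrow> 'm" where
  "cont_comp G F = (\<lambda>h. F (G h))"

text \<open>In \<open>cont_tensor S k c d F G\<close>, the objects \<open>c\<close> and \<open>d\<close> are the codomains of \<open>F\<close> and \<open>G\<close>.\<close>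

definition cont_tensor ::
  "'e ring \<Rightarrow> ('e, 'm) lincat \<Rightarrow> 'e vs \<Rightarrow> 'e vs \<Rightarrow> ('m \<Rightarrow> 'm) \<Rightarrow> ('m \<Rightarrow> 'm) \<Rightarrow> 'm \<Rightarrow> 'm" where
  "cont_tensor S k c d F G = join k (scalar_space S) \<circ> map_prod F G \<circ> unjoin k c d"

definition cont_exl :: "'e ring \<Rightarrow> ('e, 'm) lincat \<Rightarrow> 'e vs \<Rightarrow> 'e vs \<Rightarrow> 'm \<Rightarrow> 'm" where
  "cont_exl S k a b = (\<lambda>h. join k (scalar_space S) (h, zero_mor k b (scalar_space S)))"

definition cont_exr :: "'e ring \<Rightarrow> ('e, 'm) lincat \<Rightarrow> 'e vs \<Rightarrow> 'e vs \<Rightarrow> 'm \<Rightarrow> 'm" where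
  "cont_exr S k a b = (\<lambda>h. join k (scalar_space S) (zero_mor k a (scalar_space S), h))"

definition cont_dup :: "'e ring \<Rightarrow> ('e, 'm) lincat \<Rightarrow> 'e vs \<Rightarrow> 'm \<Rightarrow> 'm" where
  "cont_dup S k a = (\<lambda>h. let (h1, h2) = unjoin k a a h in add_mor k a (scalar_space S) h1 h2)"

definition cont_inl :: "('e, 'm) lincat \<Rightarrow> 'e vs \<Rightarrow> 'e vs \<Rightarrow> 'm \<Rightarrow> 'm" where
  "cont_inl k a b = (\<lambda>h. fst (unjoin k a b h))"

definition cont_inr :: "('e, 'm) lincat \<Rightarrow> 'e vs \<Rightarrow> 'e vs \<Rightarrow> 'm \<Rightarrow> 'm" where
  "cont_inr k a b = (\<lambda>h. snd (unjoin k a b h))"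

definition cont_jam :: "'e ring \<Rightarrow> ('e, 'm) lincat \<Rightarrow> 'm \<Rightarrow> 'm" where
  "cont_jam S k = (\<lambda>h. join k (scalar_space S) (h, h))"

definition cont_scale :: "'e ring \<Rightarrow> ('e, 'm) lincat \<Rightarrow> 'e \<Rightarrow> 'm \<Rightarrow> 'm" where
  "cont_scale S k c = (\<lambda>h. scale k c (scalar_space S) \<cdot>\<^bsub>k\<^esub> h)"

datatype 'm dual = Dual 'm

definition DualHom :: "('e, 'm) lincat \<Rightarrow> 'e vs \<Rightarrow> 'e vs \<Rightarrow> 'm dual set" where
  "DualHom k a b = Dual ` Hom k b a"

definition dual_id :: "('e, 'm) lincat \<Rightarrow> 'e vs \<Rightarrow> 'm dual" where
  "dual_id k a = Dual (ident k a)"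

fun dual_comp :: "('e, 'm) lincat \<Rightarrow> 'm dual \<Rightarrow> 'm dual \<Rightarrow> 'm dual" where
  "dual_comp k (Dual g) (Dual f) = Dual (f \<cdot>\<^bsub>k\<^esub> g)"

fun dual_tensor :: "('e, 'm) lincat \<Rightarrow> 'm dual \<Rightarrow> 'm dual \<Rightarrow> 'm dual" where
  "dual_tensor k (Dual f) (Dual g) = Dual (tensor k f g)"

definition dual_exl :: "('e, 'm) lincat \<Rightarrow> 'e vs \<Rightarrow> 'e vs \<Rightarrow> 'm dual" where
  "dual_exl k a b = Dual (inl k a b)"

definition dual_exr :: "('e, 'm) lincat \<Rightarrow> 'e vs \<Rightarrow> 'e vs \<Rightarrow> 'm dual" where
  "dual_exr k a b = Dual (inr k a b)"

definition dual_dup :: "('e, 'm) lincat \<Rightarrow> 'e vs \<Rightarrow> 'm dual" where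
  "dual_dup k a = Dual (jam k a)"

definition dual_inl :: "('e, 'm) lincat \<Rightarrow> 'e vs \<Rightarrow> 'e vs \<Rightarrow> 'm dual" where
  "dual_inl k a b = Dual (exl k a b)"

definition dual_inr :: "('e, 'm) lincat \<Rightarrow> 'e vs \<Rightarrow> 'e vs \<Rightarrow> 'm dual" where
  "dual_inr k a b = Dual (exr k a b)"

definition dual_jam :: "('e, 'm) lincat \<Rightarrow> 'e vs \<Rightarrow> 'm dual" where
  "dual_jam k a = Dual (dup k a)"

definition dual_scale :: "('e, 'm) lincat \<Rightarrow> 'e \<Rightarrow> 'e vs \<Rightarrow> 'm dual" where
  "dual_scale k c a = Dual (scale k c a)"

definition represents ::
  "('e, 'm) lincat \<Rightarrow> 'e vs \<Rightarrow> 'e vs \<Rightarrow> ('e \<Rightarrow> 'e) \<Rightarrow> 'm \<Rightarrow> bool" where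
  "represents k a b \<phi> m \<longleftrightarrow> m \<in> Hom k a b \<and> (\<forall>x\<in>carrier a. fun_of k m x = \<phi> x)"

definition on_dot :: "('e, 'm) lincat \<Rightarrow> 'e vs \<Rightarrow> 'e vs \<Rightarrow> ('m \<Rightarrow> 'm) \<Rightarrow> 'e \<Rightarrow> 'e" where
  "on_dot k a b F = inv_into (carrier a) (dot k a) \<circ> F \<circ> dot k b"

text \<open>
  A function \<open>F\<close> in \<open>Cont S k a b\<close> need not be linear, so \<open>on_dot k a b F\<close> need not be a morphism
  of \<open>k\<close>. The domain of \<open>asDual\<close> consists of those \<open>F\<close> for which it is; \<open>asDual\<close> is unspecified
  elsewhere.
\<close>

definition asDual_dom :: "'e ring \<Rightarrow> ('e, 'm) lincat \<Rightarrow> 'e vs \<Rightarrow> 'e vs \<Rightarrow> ('m \<Rightarrow> 'm) set" where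
  "asDual_dom S k a b = {F \<in> Cont S k a b. \<exists>m. represents k b a (on_dot k a b F) m}"

definition asDual :: "('e, 'm) lincat \<Rightarrow> 'e vs \<Rightarrow> 'e vs \<Rightarrow> ('m \<Rightarrow> 'm) \<Rightarrow> 'm dual" where
  "asDual k a b F = Dual (THE m. represents k b a (on_dot k a b F) m)"

end

theory Submission
  imports Defs
begin

text \<open>
  The morphism \<open>asDual F\<close> is the unique \<open>m\<close> such that \<open>F (dot x) = dot (m x)\<close> for all \<open>x\<close>, because
  \<open>dot\<close> is bijective and morphisms are determined by the functions they represent. Each law
  therefore reduces to checking this intertwining relation for the expected \<open>m\<close>. For the
  biproduct structure it is read off from \<open>dot (x, y) = join (dot x, dot y)\<close>, from the identity
  \<open>unjoin \<circ> join = id\<close>, and from the linearity of \<open>dot\<close>.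
\<close>

lemma scalar_space_simps [simp]:
  "carrier (scalar_space S) = carrier S"
  "zero (scalar_space S) = zero S"
  "add (scalar_space S) = add S"
  "smult (scalar_space S) = mult S"
  by (simp_all add: scalar_space_def)

lemma carrier_prod_space:
  "carrier (prod_space k a b) = pairing k ` (carrier a \<times> carrier b)"
  by (simp add: prod_space_def Let_def)

section \<open>Vector space arithmetic on objects and linearity of represented functions\<close>

context linear_category
begin

lemma Ob_zero_closed: "a \<in> Ob k \<Longrightarrow> \<zero>\<^bsub>a\<^esub> \<in> carrier a"
  using Ob_module[of a] by (meson abelian_group.axioms(1) abelian_monoid.zero_closed module_def)

lemma Ob_add_closed:
  "\<lbrakk>a \<in> Ob k; x \<in> carrier a; y \<in> carrier a\<rbrakk> \<Longrightarrow> x \<oplus>\<^bsub>a\<^esub> y \<in> carrier a"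
  using Ob_module[of a] by (meson abelian_group.axioms(1) abelian_monoid.a_closed module_def)

lemma Ob_add_zero_right: "\<lbrakk>a \<in> Ob k; x \<in> carrier a\<rbrakk> \<Longrightarrow> x \<oplus>\<^bsub>a\<^esub> \<zero>\<^bsub>a\<^esub> = x"
  using Ob_module[of a] by (meson abelian_group.axioms(1) abelian_monoid.r_zero module_def)

lemma Ob_add_zero_left: "\<lbrakk>a \<in> Ob k; x \<in> carrier a\<rbrakk> \<Longrightarrow> \<zero>\<^bsub>a\<^esub> \<oplus>\<^bsub>a\<^esub> x = x"
  using Ob_module[of a] by (meson abelian_group.axioms(1) abelian_monoid.l_zero module_def)

lemma Ob_smult_zero_left: "\<lbrakk>a \<in> Ob k; x \<in> carrier a\<rbrakk> \<Longrightarrow> \<zero> \<odot>\<^bsub>a\<^esub> x = \<zero>\<^bsub>a\<^esub>"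
  using Ob_module[of a] by (rule module.smult_l_null)

lemma Ob_smult_closed:
  "\<lbrakk>a \<in> Ob k; c \<in> carrier S; x \<in> carrier a\<rbrakk> \<Longrightarrow> c \<odot>\<^bsub>a\<^esub> x \<in> carrier a"
  using Ob_module[of a] by (rule module.smult_closed)

lemma fun_of_closed:
  "\<lbrakk>a \<in> Ob k; b \<in> Ob k; f \<in> Hom k a b; x \<in> carrier a\<rbrakk> \<Longrightarrow> fun_of k f x \<in> carrier b"
  using fun_of_linear[of a b f] by (auto simp: linear_map_def)

text \<open>Homogeneity suffices: the zero vector is the zero scalar times itself, and the scalar
  passes through \<open>fun_of k f\<close>.\<close>

lemma fun_of_zero:
  assumes "a \<in> Ob k" "b \<in> Ob k" "f \<in> Hom k a b"
  shows "fun_of k f \<zero>\<^bsub>a\<^esub> = \<zero>\<^bsub>b\<^esub>"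
proof -
  have "fun_of k f \<zero>\<^bsub>a\<^esub> = fun_of k f (\<zero> \<odot>\<^bsub>a\<^esub> \<zero>\<^bsub>a\<^esub>)"
    using assms by (simp add: Ob_smult_zero_left Ob_zero_closed)
  also have "\<dots> = \<zero> \<odot>\<^bsub>b\<^esub> fun_of k f \<zero>\<^bsub>a\<^esub>"
    using assms fun_of_linear[of a b f] by (simp add: linear_map_def Ob_zero_closed)
  also have "\<dots> = \<zero>\<^bsub>b\<^esub>"
    using assms by (simp add: Ob_smult_zero_left fun_of_closed Ob_zero_closed)
  finally show ?thesis .
qed

end

section \<open>Joins, sums and zero morphisms computed on elements\<close>

context biproduct_category
begin

lemma join_Hom:
  assumes "a \<in> Ob k" "b \<in> Ob k" "c \<in> Ob k" "p \<in> Hom k a c" "q \<in> Hom k b c"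
  shows "join k c (p, q) \<in> Hom k (prod_space k a b) c"
  unfolding join_def prod.case
  using assms
  \<comment> \<open>The middle object is given explicitly: a composite does not mention it, so
    matching against the goal cannot determine it.\<close>
  by (intro compose_Hom[of "prod_space k a b" "prod_space k c c"])
    (simp_all add: jam_Hom prod_Ob tensor_Hom)

lemma fun_of_join:
  assumes "a \<in> Ob k" "b \<in> Ob k" "c \<in> Ob k" "p \<in> Hom k a c" "q \<in> Hom k b c"
    and "x \<in> carrier a" "y \<in> carrier b"
  shows "fun_of k (join k c (p, q)) (pairing k (x, y)) = fun_of k p x \<oplus>\<^bsub>c\<^esub> fun_of k q y"
proof -
  have "pairing k (x, y) \<in> carrier (prod_space k a b)"
    using assms by (simp add: carrier_prod_space)
  then have "fun_of k (join k c (p, q)) (pairing k (x, y)) =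
      fun_of k (jam k c) (fun_of k (tensor k p q) (pairing k (x, y)))"
    unfolding join_def prod.case
    using assms
    by (intro fun_of_compose[of "prod_space k a b" "prod_space k c c" c])
      (simp_all add: prod_Ob jam_Hom tensor_Hom[of a b c c p q])
  also have "\<dots> = fun_of k p x \<oplus>\<^bsub>c\<^esub> fun_of k q y"
    using assms
    by (simp add: fun_of_tensor[of a b c c] fun_of_jam fun_of_closed[of a c p]
        fun_of_closed[of b c q])
  finally show ?thesis .
qed

lemma unjoin_Hom:
  assumes "a \<in> Ob k" "b \<in> Ob k" "c \<in> Ob k" "h \<in> Hom k (prod_space k a b) c"
  shows "h \<cdot>\<^bsub>k\<^esub> inl k a b \<in> Hom k a c" "h \<cdot>\<^bsub>k\<^esub> inr k a b \<in> Hom k b c"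
  using assms
    compose_Hom[of a "prod_space k a b" c "inl k a b" h]
    compose_Hom[of b "prod_space k a b" c "inr k a b" h]
  by (simp_all add: prod_Ob inl_Hom inr_Hom)

text \<open>Precomposing with an injection fills the other slot with zero. The other morphism sends
  that zero to zero, so only one summand survives, and faithfulness lifts this pointwise identity to
  morphisms.\<close>

lemma unjoin_join:
  assumes "a \<in> Ob k" "b \<in> Ob k" "c \<in> Ob k" "p \<in> Hom k a c" "q \<in> Hom k b c"
  shows "unjoin k a b (join k c (p, q)) = (p, q)"
proof -
  note J = join_Hom[OF assms]
  have "join k c (p, q) \<cdot>\<^bsub>k\<^esub> inl k a b = p"
  proof (rule faithful[OF assms(1,3) _ assms(4)])
    show "join k c (p, q) \<cdot>\<^bsub>k\<^esub> inl k a b \<in> Hom k a c"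
      using assms J by (simp add: unjoin_Hom)
    fix x assume x: "x \<in> carrier a"
    have "fun_of k (join k c (p, q) \<cdot>\<^bsub>k\<^esub> inl k a b) x =
        fun_of k (join k c (p, q)) (pairing k (x, \<zero>\<^bsub>b\<^esub>))"
      using assms J x
      by (simp add: fun_of_compose[of a "prod_space k a b" c] prod_Ob inl_Hom fun_of_inl)
    also have "\<dots> = fun_of k p x"
      using assms x
      by (simp add: fun_of_join Ob_zero_closed fun_of_zero[of b c] fun_of_closed[of a c]
          Ob_add_zero_right)
    finally show "fun_of k (join k c (p, q) \<cdot>\<^bsub>k\<^esub> inl k a b) x = fun_of k p x" .
  qed
  moreover have "join k c (p, q) \<cdot>\<^bsub>k\<^esub> inr k a b = q"
  proof (rule faithful[OF assms(2,3) _ assms(5)])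
    show "join k c (p, q) \<cdot>\<^bsub>k\<^esub> inr k a b \<in> Hom k b c"
      using assms J by (simp add: unjoin_Hom)
    fix y assume y: "y \<in> carrier b"
    have "fun_of k (join k c (p, q) \<cdot>\<^bsub>k\<^esub> inr k a b) y =
        fun_of k (join k c (p, q)) (pairing k (\<zero>\<^bsub>a\<^esub>, y))"
      using assms J y
      by (simp add: fun_of_compose[of b "prod_space k a b" c] prod_Ob inr_Hom fun_of_inr)
    also have "\<dots> = fun_of k q y"
      using assms y
      by (simp add: fun_of_join Ob_zero_closed fun_of_zero[of a c] fun_of_closed[of b c]
          Ob_add_zero_left)
    finally show "fun_of k (join k c (p, q) \<cdot>\<^bsub>k\<^esub> inr k a b) y = fun_of k q y" .
  qed
  ultimately show ?thesis
    by (simp add: unjoin_def)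
qed

lemma add_mor_Hom:
  assumes "a \<in> Ob k" "b \<in> Ob k" "f \<in> Hom k b a" "g \<in> Hom k b a"
  shows "add_mor k b a f g \<in> Hom k b a"
  unfolding add_mor_def
  using assms
  by (intro compose_Hom[of b "prod_space k a a" a] compose_Hom[of b "prod_space k b b"])
    (simp_all add: jam_Hom dup_Hom prod_Ob tensor_Hom)

text \<open>\<open>dup\<close> copies the argument, \<open>tensor\<close> applies \<open>f\<close>
  and \<open>g\<close> to the copies and \<open>jam\<close> adds the results, so the categorical sum
  is the pointwise one.\<close>

lemma fun_of_add_mor:
  assumes "a \<in> Ob k" "b \<in> Ob k" "f \<in> Hom k b a" "g \<in> Hom k b a" "x \<in> carrier b"
  shows "fun_of k (add_mor k b a f g) x = fun_of k f x \<oplus>\<^bsub>a\<^esub> fun_of k g x"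
proof -
  have T: "tensor k f g \<in> Hom k (prod_space k b b) (prod_space k a a)"
    using assms by (simp add: tensor_Hom)
  have D: "dup k b \<in> Hom k b (prod_space k b b)"
    using assms by (simp add: dup_Hom)
  have "tensor k f g \<cdot>\<^bsub>k\<^esub> dup k b \<in> Hom k b (prod_space k a a)"
    using assms T D by (intro compose_Hom[of b "prod_space k b b"]) (simp_all add: prod_Ob)
  then have "fun_of k (add_mor k b a f g) x =
      fun_of k (jam k a) (fun_of k (tensor k f g \<cdot>\<^bsub>k\<^esub> dup k b) x)"
    unfolding add_mor_def
    using assms by (intro fun_of_compose[of b "prod_space k a a" a]) (simp_all add: prod_Ob jam_Hom)
  also have "fun_of k (tensor k f g \<cdot>\<^bsub>k\<^esub> dup k b) x =
      fun_of k (tensor k f g) (pairing k (x, x))"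
    using assms T D
    by (simp add: fun_of_compose[of b "prod_space k b b" "prod_space k a a"] prod_Ob fun_of_dup)
  also have "\<dots> = pairing k (fun_of k f x, fun_of k g x)"
    using assms by (simp add: fun_of_tensor[of b b a a])
  also have "fun_of k (jam k a) \<dots> = fun_of k f x \<oplus>\<^bsub>a\<^esub> fun_of k g x"
    using assms by (simp add: fun_of_jam fun_of_closed[of b a])
  finally show ?thesis .
qed

text \<open>
  That a zero object has trivial carrier is not assumed: it follows because \<open>exr \<circ> inl\<close> is a
  morphism representing the zero function, so on a zero object it must be the identity.
\<close>

lemma fun_of_exr_inl:
  assumes "a \<in> Ob k" "b \<in> Ob k"
  shows "exr k a b \<cdot>\<^bsub>k\<^esub> inl k a b \<in> Hom k a b"
    and "x \<in> carrier a \<Longrightarrow> fun_of k (exr k a b \<cdot>\<^bsub>k\<^esub> inl k a b) x = \<zero>\<^bsub>b\<^esub>"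
proof -
  show "exr k a b \<cdot>\<^bsub>k\<^esub> inl k a b \<in> Hom k a b"
    using assms by (simp add: unjoin_Hom exr_Hom)
  assume "x \<in> carrier a"
  then show "fun_of k (exr k a b \<cdot>\<^bsub>k\<^esub> inl k a b) x = \<zero>\<^bsub>b\<^esub>"
    using assms
    by (simp add: fun_of_compose[of a "prod_space k a b" b] prod_Ob inl_Hom exr_Hom fun_of_inl
        fun_of_exr Ob_zero_closed)
qed

lemma zero_object_carrier:
  assumes "zero_object k z" "x \<in> carrier z"
  shows "x = \<zero>\<^bsub>z\<^esub>"
proof -
  have z: "z \<in> Ob k"
    using assms by (simp add: zero_object_def)
  have "\<exists>!p. p \<in> Hom k z z"
    using assms z by (simp add: zero_object_def)
  then have "ident k z = exr k z z \<cdot>\<^bsub>k\<^esub> inl k z z"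
    using fun_of_exr_inl(1)[OF z z] ident_Hom[OF z] by auto
  then show ?thesis
    using fun_of_exr_inl(2)[OF z z assms(2)] fun_of_ident[OF z assms(2)] by simp
qed

text \<open>The definite description in \<open>zero_mor\<close> ranges over all zero objects and all
  factorisations, so its value has to be shown independent of both. Any composite through a zero
  object represents the zero function, as does \<open>exr\<close> after \<open>inl\<close>, and
  faithfulness identifies the two.\<close>

lemma zero_mor_eq:
  assumes "a \<in> Ob k" "b \<in> Ob k"
  shows "zero_mor k a b = exr k a b \<cdot>\<^bsub>k\<^esub> inl k a b"
proof -
  have factor: "q \<cdot>\<^bsub>k\<^esub> p = exr k a b \<cdot>\<^bsub>k\<^esub> inl k a b"
    if z: "zero_object k z" and p: "p \<in> Hom k a z" and q: "q \<in> Hom k z b" for z p q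
  proof (rule faithful[OF assms])
    have zOb: "z \<in> Ob k"
      using z by (simp add: zero_object_def)
    show "q \<cdot>\<^bsub>k\<^esub> p \<in> Hom k a b"
      using assms(1) zOb assms(2) p q by (rule compose_Hom)
    fix x assume x: "x \<in> carrier a"
    have "fun_of k p x = \<zero>\<^bsub>z\<^esub>"
      using zero_object_carrier[OF z] fun_of_closed[OF assms(1) zOb p x] .
    then show "fun_of k (q \<cdot>\<^bsub>k\<^esub> p) x = fun_of k (exr k a b \<cdot>\<^bsub>k\<^esub> inl k a b) x"
      using assms zOb p q x
      by (simp add: fun_of_compose[of a z b] fun_of_zero[of z b] fun_of_exr_inl)
  qed (use assms in \<open>simp add: fun_of_exr_inl\<close>)
  obtain z where z: "zero_object k z"
    using ex_zero_object ..
  \<comment> \<open>Existence for the definite description: the zero object provides some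
    factorisation, and \<open>factor\<close> says what its composite is.\<close>
  have "\<exists>p. p \<in> Hom k a z" "\<exists>q. q \<in> Hom k z b"
    using z assms by (auto simp: zero_object_def intro: ex1_implies_ex)
  then obtain p q where pq: "p \<in> Hom k a z" "q \<in> Hom k z b"
    by blast
  show ?thesis
    unfolding zero_mor_def
  proof (rule the_equality)
    show "\<exists>z p q. zero_object k z \<and> p \<in> Hom k a z \<and> q \<in> Hom k z b \<and>
        exr k a b \<cdot>\<^bsub>k\<^esub> inl k a b = q \<cdot>\<^bsub>k\<^esub> p"
      using z pq factor[OF z pq] by (intro exI[of _ z] exI[of _ p] exI[of _ q]) simp
  qed (auto simp: factor)
qed

lemma zero_mor_Hom: "\<lbrakk>a \<in> Ob k; b \<in> Ob k\<rbrakk> \<Longrightarrow> zero_mor k a b \<in> Hom k a b"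
  by (simp add: zero_mor_eq fun_of_exr_inl)

lemma fun_of_zero_mor:
  "\<lbrakk>a \<in> Ob k; b \<in> Ob k; x \<in> carrier a\<rbrakk> \<Longrightarrow> fun_of k (zero_mor k a b) x = \<zero>\<^bsub>b\<^esub>"
  by (simp add: zero_mor_eq fun_of_exr_inl)

end

section \<open>Characterisation of \<open>asDual\<close> by intertwining with the dot
  product\<close>

context dot_category
begin

lemma Dots_in_Ob: "a \<in> Dots k \<Longrightarrow> a \<in> Ob k"
  using Dots_Ob by blast

lemma dot_Hom: "\<lbrakk>a \<in> Dots k; x \<in> carrier a\<rbrakk> \<Longrightarrow> dot k a x \<in> Hom k a (scalar_space S)"
  using dot_bij bij_betwE by blast

text \<open>Every law is proved through this rule. Cancelling the injective \<open>dot k a\<close>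
  shows that \<open>m\<close> represents \<open>on_dot k a b F\<close>; faithfulness makes
  \<open>m\<close> the only such morphism, so the definite description in \<open>asDual\<close>
  returns it.\<close>

lemma asDual_eqI:
  assumes a: "a \<in> Dots k" and b: "b \<in> Dots k"
    and F: "F \<in> Cont S k a b" and m: "m \<in> Hom k b a"
    and eq: "\<And>x. x \<in> carrier b \<Longrightarrow> F (dot k b x) = dot k a (fun_of k m x)"
  shows "F \<in> asDual_dom S k a b \<and> asDual k a b F = Dual m"
proof -
  have "on_dot k a b F x = fun_of k m x" if "x \<in> carrier b" for x
    using that eq[OF that] bij_betw_inv_into_left[OF dot_bij[OF a]]
      fun_of_closed[OF Dots_in_Ob[OF b] Dots_in_Ob[OF a] m that]
    by (simp add: on_dot_def)
  then have rep: "represents k b a (on_dot k a b F) m"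
    using m by (simp add: represents_def)
  then have "(THE m. represents k b a (on_dot k a b F) m) = m"
    using faithful[OF Dots_in_Ob[OF b] Dots_in_Ob[OF a]]
    by (intro the_equality) (auto simp: represents_def)
  then show ?thesis
    using rep F by (auto simp: asDual_def asDual_dom_def)
qed

text \<open>Converse of \<open>asDual_eqI\<close>. Here surjectivity of \<open>dot k a\<close>
  matters: \<open>F (dot k b x)\<close> lies in \<open>Hom k a (scalar_space S)\<close>, so applying
  the inverse of \<open>dot k a\<close> and then \<open>dot k a\<close> returns it.\<close>

lemma asDual_domE:
  assumes a: "a \<in> Dots k" and b: "b \<in> Dots k" and F: "F \<in> asDual_dom S k a b"
  obtains m where "F \<in> Cont S k a b" "m \<in> Hom k b a" "asDual k a b F = Dual m"
    "\<And>x. x \<in> carrier b \<Longrightarrow> F (dot k b x) = dot k a (fun_of k m x)"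
proof -
  from F obtain m where C: "F \<in> Cont S k a b" and rep: "represents k b a (on_dot k a b F) m"
    by (auto simp: asDual_dom_def)
  then have m: "m \<in> Hom k b a"
    by (simp add: represents_def)
  have eq: "F (dot k b x) = dot k a (fun_of k m x)" if x: "x \<in> carrier b" for x
  proof -
    have "F (dot k b x) \<in> Hom k a (scalar_space S)"
      using C dot_Hom[OF b x] by (auto simp: Cont_def)
    then have "dot k a (inv_into (carrier a) (dot k a) (F (dot k b x))) = F (dot k b x)"
      using bij_betw_inv_into_right[OF dot_bij[OF a]] by blast
    then show ?thesis
      using rep x by (simp add: represents_def on_dot_def)
  qed
  show ?thesis
    using that[OF C m _ eq] asDual_eqI[OF a b C m eq] by blast
qed

lemma asDual_closed:
  assumes "a \<in> Dots k" "b \<in> Dots k" "F \<in> asDual_dom S k a b"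
  shows "asDual k a b F \<in> DualHom k a b"
  by (rule asDual_domE[OF assms]) (simp add: DualHom_def)

section \<open>The Category and Scalable laws\<close>

lemma asDual_cont_id:
  assumes a: "a \<in> Dots k"
  shows "cont_id \<in> asDual_dom S k a a \<and> asDual k a a cont_id = dual_id k a"
  unfolding dual_id_def
  by (rule asDual_eqI[OF a a])
    (auto simp: cont_id_def Cont_def ident_Hom fun_of_ident Dots_in_Ob a)

text \<open>The two relations chain: \<open>f (g (dot x)) = f (dot (n x)) = dot (m (n x))\<close>.
  Both \<open>cont_comp\<close> and \<open>dual_comp\<close> reverse the order of composition, so
  the two sides agree.\<close>

lemma asDual_cont_comp:
  assumes a: "a \<in> Dots k" and b: "b \<in> Dots k" and c: "c \<in> Dots k"
    and f: "f \<in> asDual_dom S k a b" and g: "g \<in> asDual_dom S k b c"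
  shows "cont_comp g f \<in> asDual_dom S k a c \<and>
    asDual k a c (cont_comp g f) = dual_comp k (asDual k b c g) (asDual k a b f)"
proof -
  note Ob = Dots_in_Ob[OF a] Dots_in_Ob[OF b] Dots_in_Ob[OF c]
  obtain m where m: "f \<in> Cont S k a b" "m \<in> Hom k b a" "asDual k a b f = Dual m"
    "\<And>x. x \<in> carrier b \<Longrightarrow> f (dot k b x) = dot k a (fun_of k m x)"
    using asDual_domE[OF a b f] by blast
  obtain n where n: "g \<in> Cont S k b c" "n \<in> Hom k c b" "asDual k b c g = Dual n"
    "\<And>x. x \<in> carrier c \<Longrightarrow> g (dot k c x) = dot k b (fun_of k n x)"
    using asDual_domE[OF b c g] by blast
  have "cont_comp g f \<in> asDual_dom S k a c \<and> asDual k a c (cont_comp g f) = Dual (m \<cdot>\<^bsub>k\<^esub> n)"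
  proof (rule asDual_eqI[OF a c])
    show "cont_comp g f \<in> Cont S k a c"
      using m(1) n(1) by (auto simp: Cont_def cont_comp_def)
    show "m \<cdot>\<^bsub>k\<^esub> n \<in> Hom k c a"
      \<comment> \<open>The objects are listed in reverse, because \<open>n\<close> goes from
        \<open>c\<close> to \<open>b\<close> and \<open>m\<close> from \<open>b\<close> to
        \<open>a\<close>.\<close>
      using Ob(3,2,1) n(2) m(2) by (rule compose_Hom)
    fix x assume "x \<in> carrier c"
    then show "cont_comp g f (dot k c x) = dot k a (fun_of k (m \<cdot>\<^bsub>k\<^esub> n) x)"
      using Ob m n by (simp add: cont_comp_def fun_of_compose[of c b a] fun_of_closed[of c b])
  qed
  then show ?thesis
    using m(3) n(3) by simp
qed

text \<open>By homogeneity of \<open>dot\<close> in its first argument, scaling the functional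
  \<open>dot x\<close> is the same as scaling the vector \<open>x\<close>.\<close>

lemma asDual_cont_scale:
  assumes "scalable_category S k" and c: "c \<in> carrier S" and a: "a \<in> Dots k"
  shows "cont_scale S k c \<in> asDual_dom S k a a \<and>
    asDual k a a (cont_scale S k c) = dual_scale k c a"
  unfolding dual_scale_def
proof (rule asDual_eqI[OF a a])
  interpret scalable_category S k by fact
  note Ob = Dots_in_Ob[OF a] scalar_Ob
  have scale_comp: "scale k c (scalar_space S) \<cdot>\<^bsub>k\<^esub> h \<in> Hom k a (scalar_space S)"
    if "h \<in> Hom k a (scalar_space S)" for h
    using Ob(1) scalar_Ob scalar_Ob that scale_Hom[OF c scalar_Ob] by (rule compose_Hom)
  then show "cont_scale S k c \<in> Cont S k a a"
    by (simp add: Cont_def cont_scale_def)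
  show "scale k c a \<in> Hom k a a"
    using Ob c by (simp add: scale_Hom)
  fix x assume x: "x \<in> carrier a"
  have cx: "c \<odot>\<^bsub>a\<^esub> x \<in> carrier a"
    using Ob c x by (simp add: Ob_smult_closed)
  have "scale k c (scalar_space S) \<cdot>\<^bsub>k\<^esub> dot k a x = dot k a (c \<odot>\<^bsub>a\<^esub> x)"
  proof (rule faithful[OF Ob scale_comp[OF dot_Hom[OF a x]] dot_Hom[OF a cx]])
    fix y assume y: "y \<in> carrier a"
    \<comment> \<open>Being a scalar, this value is multiplied by \<open>c\<close> under
      \<open>scale k c (scalar_space S)\<close>, which is what \<open>dot_smult\<close> produces on
      the other side.\<close>
    have "fun_of k (dot k a x) y \<in> carrier S"
      using fun_of_closed[OF Ob dot_Hom[OF a x] y] by simp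
    then show "fun_of k (scale k c (scalar_space S) \<cdot>\<^bsub>k\<^esub> dot k a x) y =
        fun_of k (dot k a (c \<odot>\<^bsub>a\<^esub> x)) y"
      using a c x y Ob dot_Hom[OF a x]
      by (simp add: fun_of_compose[of a "scalar_space S" "scalar_space S"] scale_Hom fun_of_scale
          dot_smult)
  qed
  then show "cont_scale S k c (dot k a x) = dot k a (fun_of k (scale k c a) x)"
    using Ob c x by (simp add: cont_scale_def fun_of_scale)
qed

end

section \<open>The dot product on zero, pairs and sums\<close>

locale dot_biproduct_category = dot_category + biproduct_category
begin

text \<open>Needed for the projections: the zero morphism inserted by \<open>cont_exl\<close> and
  \<open>cont_exr\<close> must be recognised as the dot product with the zero component that
  \<open>inl\<close> and \<open>inr\<close> insert.\<close>

lemma dot_zero: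
  assumes a: "a \<in> Dots k"
  shows "dot k a \<zero>\<^bsub>a\<^esub> = zero_mor k a (scalar_space S)"
proof (rule faithful[OF Dots_in_Ob[OF a] scalar_Ob])
  note Ob = Dots_in_Ob[OF a] scalar_Ob
  have 0: "\<zero>\<^bsub>a\<^esub> \<in> carrier a"
    using Ob by (simp add: Ob_zero_closed)
  show D: "dot k a \<zero>\<^bsub>a\<^esub> \<in> Hom k a (scalar_space S)"
    using dot_Hom[OF a 0] .
  show "zero_mor k a (scalar_space S) \<in> Hom k a (scalar_space S)"
    using Ob by (simp add: zero_mor_Hom)
  fix y assume y: "y \<in> carrier a"
  \<comment> \<open>The zero vector is written as a zero multiple so that \<open>dot_smult\<close>
    extracts the factor zero.\<close>
  have "fun_of k (dot k a (\<zero> \<odot>\<^bsub>a\<^esub> \<zero>\<^bsub>a\<^esub>)) y = \<zero>"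
    using dot_smult[OF a S.zero_closed 0 y] fun_of_closed[OF Ob D y] by simp
  then show "fun_of k (dot k a \<zero>\<^bsub>a\<^esub>) y = fun_of k (zero_mor k a (scalar_space S)) y"
    using Ob 0 y by (simp add: Ob_smult_zero_left fun_of_zero_mor)
qed

text \<open>In \<open>dot_category\<close> this law is conditional on the biproduct structure; the
  combined locale discharges the condition.\<close>

lemma dot_pairing:
  assumes "a \<in> Dots k" "b \<in> Dots k" "x \<in> carrier a" "y \<in> carrier b"
  shows "dot k (prod_space k a b) (pairing k (x, y)) =
    join k (scalar_space S) (dot k a x, dot k b y)"
  by (rule dot_prod[OF biproduct_category_axioms assms])

lemma prod_in_Dots: "\<lbrakk>a \<in> Dots k; b \<in> Dots k\<rbrakk> \<Longrightarrow> prod_space k a b \<in> Dots k"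
  by (rule prod_Dots[OF biproduct_category_axioms])

text \<open>The dot product with a pair is a join, which \<open>unjoin\<close> splits again. This
  evaluates \<open>cont_dup\<close>, \<open>cont_inl\<close> and \<open>cont_inr\<close>.\<close>

lemma unjoin_dot_pairing:
  assumes "a \<in> Dots k" "b \<in> Dots k" "x \<in> carrier a" "y \<in> carrier b"
  shows "unjoin k a b (dot k (prod_space k a b) (pairing k (x, y))) = (dot k a x, dot k b y)"
  using assms by (simp add: dot_pairing unjoin_join scalar_Ob Dots_in_Ob dot_Hom)

text \<open>Pointwise, this is additivity of \<open>dot\<close> in its first argument.\<close>

lemma add_mor_dot:
  assumes a: "a \<in> Dots k" and x: "x \<in> carrier a" and y: "y \<in> carrier a"
  shows "add_mor k a (scalar_space S) (dot k a x) (dot k a y) = dot k a (x \<oplus>\<^bsub>a\<^esub> y)"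
proof (rule faithful[OF Dots_in_Ob[OF a] scalar_Ob])
  show "dot k a (x \<oplus>\<^bsub>a\<^esub> y) \<in> Hom k a (scalar_space S)"
    using assms by (simp add: dot_Hom Ob_add_closed Dots_in_Ob)
qed (use assms in \<open>simp_all add: add_mor_Hom fun_of_add_mor scalar_Ob Dots_in_Ob dot_Hom dot_add\<close>)

section \<open>The Monoidal, Cartesian and Cocartesian laws\<close>

lemma asDual_cont_tensor:
  assumes a: "a \<in> Dots k" and b: "b \<in> Dots k" and c: "c \<in> Dots k" and d: "d \<in> Dots k"
    and f: "f \<in> asDual_dom S k a c" and g: "g \<in> asDual_dom S k b d"
  shows "cont_tensor S k c d f g \<in> asDual_dom S k (prod_space k a b) (prod_space k c d) \<and>
    asDual k (prod_space k a b) (prod_space k c d) (cont_tensor S k c d f g) =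
      dual_tensor k (asDual k a c f) (asDual k b d g)"
proof -
  note Ob = Dots_in_Ob[OF a] Dots_in_Ob[OF b] Dots_in_Ob[OF c] Dots_in_Ob[OF d] scalar_Ob
  obtain m where m: "f \<in> Cont S k a c" "m \<in> Hom k c a" "asDual k a c f = Dual m"
    "\<And>x. x \<in> carrier c \<Longrightarrow> f (dot k c x) = dot k a (fun_of k m x)"
    using asDual_domE[OF a c f] by blast
  obtain n where n: "g \<in> Cont S k b d" "n \<in> Hom k d b" "asDual k b d g = Dual n"
    "\<And>x. x \<in> carrier d \<Longrightarrow> g (dot k d x) = dot k b (fun_of k n x)"
    using asDual_domE[OF b d g] by blast
  have "cont_tensor S k c d f g \<in> asDual_dom S k (prod_space k a b) (prod_space k c d) \<and>
    asDual k (prod_space k a b) (prod_space k c d) (cont_tensor S k c d f g) = Dual (tensor k m n)"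
  proof (rule asDual_eqI[OF prod_in_Dots[OF a b] prod_in_Dots[OF c d]])
    have "f (h \<cdot>\<^bsub>k\<^esub> inl k c d) \<in> Hom k a (scalar_space S)"
      "g (h \<cdot>\<^bsub>k\<^esub> inr k c d) \<in> Hom k b (scalar_space S)"
      if "h \<in> Hom k (prod_space k c d) (scalar_space S)" for h
      using m(1) n(1) unjoin_Hom[OF Ob(3-5) that] by (auto simp: Cont_def)
    then show "cont_tensor S k c d f g \<in> Cont S k (prod_space k a b) (prod_space k c d)"
      using Ob by (simp add: Cont_def cont_tensor_def unjoin_def join_Hom)
    show "tensor k m n \<in> Hom k (prod_space k c d) (prod_space k a b)"
      using Ob m(2) n(2) by (simp add: tensor_Hom)
    fix z assume "z \<in> carrier (prod_space k c d)"
    then obtain x y where "x \<in> carrier c" "y \<in> carrier d" "z = pairing k (x, y)"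
      by (auto simp: carrier_prod_space)
    \<comment> \<open>\<open>unjoin\<close> yields \<open>(dot x, dot y)\<close>, the continuations
      turn this into \<open>(dot (m x), dot (n y))\<close>, and \<open>join\<close> reassembles the
      dot product with \<open>(m x, n y)\<close>.\<close>
    then show "cont_tensor S k c d f g (dot k (prod_space k c d) z) =
        dot k (prod_space k a b) (fun_of k (tensor k m n) z)"
      using a b c d Ob m n
      by (simp add: cont_tensor_def unjoin_join dot_Hom fun_of_tensor[of c d a b] dot_pairing
          fun_of_closed[of c a] fun_of_closed[of d b])
  qed
  then show ?thesis
    using m(3) n(3) by simp
qed

text \<open>By \<open>dot_zero\<close>, joining \<open>dot x\<close> with the zero morphism gives
  the dot product with \<open>(x, 0)\<close>, the image of \<open>x\<close> under
  \<open>inl\<close>. The case of \<open>exr\<close> is symmetric.\<close>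

lemma asDual_cont_exl:
  assumes a: "a \<in> Dots k" and b: "b \<in> Dots k"
  shows "cont_exl S k a b \<in> asDual_dom S k (prod_space k a b) a \<and>
    asDual k (prod_space k a b) a (cont_exl S k a b) = dual_exl k a b"
  unfolding dual_exl_def
  using a b
  by (intro asDual_eqI prod_in_Dots)
    (simp_all add: Cont_def cont_exl_def join_Hom zero_mor_Hom inl_Hom fun_of_inl dot_pairing
      dot_zero Ob_zero_closed Dots_in_Ob scalar_Ob)

lemma asDual_cont_exr:
  assumes a: "a \<in> Dots k" and b: "b \<in> Dots k"
  shows "cont_exr S k a b \<in> asDual_dom S k (prod_space k a b) b \<and>
    asDual k (prod_space k a b) b (cont_exr S k a b) = dual_exr k a b"
  unfolding dual_exr_def
  using a b
  by (intro asDual_eqI prod_in_Dots)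
    (simp_all add: Cont_def cont_exr_def join_Hom zero_mor_Hom inr_Hom fun_of_inr dot_pairing
      dot_zero Ob_zero_closed Dots_in_Ob scalar_Ob)

text \<open>The dot product with \<open>(x, y)\<close> is sent to \<open>dot x + dot y\<close>,
  which is \<open>dot (x + y)\<close>; the vector has been transformed by
  \<open>jam\<close>.\<close>

lemma asDual_cont_dup:
  assumes a: "a \<in> Dots k"
  shows "cont_dup S k a \<in> asDual_dom S k a (prod_space k a a) \<and>
    asDual k a (prod_space k a a) (cont_dup S k a) = dual_dup k a"
  unfolding dual_dup_def
proof (rule asDual_eqI[OF a prod_in_Dots[OF a a]])
  show "cont_dup S k a \<in> Cont S k a (prod_space k a a)"
    using a
    by (simp add: Cont_def cont_dup_def unjoin_def unjoin_Hom add_mor_Hom Dots_in_Ob scalar_Ob)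
  show "jam k a \<in> Hom k (prod_space k a a) a"
    using a by (simp add: jam_Hom Dots_in_Ob)
  fix z assume "z \<in> carrier (prod_space k a a)"
  then show "cont_dup S k a (dot k (prod_space k a a) z) = dot k a (fun_of k (jam k a) z)"
    using a
    by (auto simp: carrier_prod_space cont_dup_def unjoin_dot_pairing add_mor_dot fun_of_jam
        Dots_in_Ob)
qed

text \<open>Restricting the dot product with \<open>(x, y)\<close> to the first factor leaves
  \<open>dot x\<close>, so the vector is transformed by the first projection; \<open>inr\<close> is
  analogous.\<close>

lemma asDual_cont_inl:
  assumes a: "a \<in> Dots k" and b: "b \<in> Dots k"
  shows "cont_inl k a b \<in> asDual_dom S k a (prod_space k a b) \<and>
    asDual k a (prod_space k a b) (cont_inl k a b) = dual_inl k a b"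
  unfolding dual_inl_def
proof (rule asDual_eqI[OF a prod_in_Dots[OF a b]])
  show "cont_inl k a b \<in> Cont S k a (prod_space k a b)"
    using a b by (simp add: Cont_def cont_inl_def unjoin_def unjoin_Hom Dots_in_Ob scalar_Ob)
  show "exl k a b \<in> Hom k (prod_space k a b) a"
    using a b by (simp add: exl_Hom Dots_in_Ob)
  fix z assume "z \<in> carrier (prod_space k a b)"
  then show "cont_inl k a b (dot k (prod_space k a b) z) = dot k a (fun_of k (exl k a b) z)"
    using a b
    by (auto simp: carrier_prod_space cont_inl_def unjoin_dot_pairing fun_of_exl Dots_in_Ob)
qed

lemma asDual_cont_inr:
  assumes a: "a \<in> Dots k" and b: "b \<in> Dots k"
  shows "cont_inr k a b \<in> asDual_dom S k b (prod_space k a b) \<and>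
    asDual k b (prod_space k a b) (cont_inr k a b) = dual_inr k a b"
  unfolding dual_inr_def
proof (rule asDual_eqI[OF b prod_in_Dots[OF a b]])
  show "cont_inr k a b \<in> Cont S k b (prod_space k a b)"
    using a b by (simp add: Cont_def cont_inr_def unjoin_def unjoin_Hom Dots_in_Ob scalar_Ob)
  show "exr k a b \<in> Hom k (prod_space k a b) b"
    using a b by (simp add: exr_Hom Dots_in_Ob)
  fix z assume "z \<in> carrier (prod_space k a b)"
  then show "cont_inr k a b (dot k (prod_space k a b) z) = dot k b (fun_of k (exr k a b) z)"
    using a b
    by (auto simp: carrier_prod_space cont_inr_def unjoin_dot_pairing fun_of_exr Dots_in_Ob)
qed

text \<open>Joining \<open>dot x\<close> with itself gives the dot product with
  \<open>(x, x)\<close>, and \<open>dup\<close> is the map from \<open>x\<close> to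
  \<open>(x, x)\<close>.\<close>

lemma asDual_cont_jam:
  assumes a: "a \<in> Dots k"
  shows "cont_jam S k \<in> asDual_dom S k (prod_space k a a) a \<and>
    asDual k (prod_space k a a) a (cont_jam S k) = dual_jam k a"
  unfolding dual_jam_def
  using a
  by (intro asDual_eqI prod_in_Dots)
    (simp_all add: Cont_def cont_jam_def join_Hom dup_Hom fun_of_dup dot_pairing Dots_in_Ob
      scalar_Ob)

end

text \<open>Membership in \<open>asDual_dom\<close> accompanies each equation for a
  \<open>Cont\<close> operation, since \<open>asDual\<close> is unspecified outside that set. The
  Monoidal law is placed under \<open>biproduct_category\<close> because \<open>cont_tensor\<close>
  is built from \<open>join\<close> and \<open>unjoin\<close>, which use \<open>jam\<close>,
  \<open>inl\<close> and \<open>inr\<close>.\<close>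

theorem theorem5:
  fixes S :: "'e ring" and k :: "('e, 'm) lincat"
  assumes "dot_category S k"
  shows
    "(\<forall>a\<in>Dots k. \<forall>b\<in>Dots k. \<forall>f\<in>asDual_dom S k a b. asDual k a b f \<in> DualHom k a b) \<and>
     \<comment> \<open>Category\<close>
     (\<forall>a\<in>Dots k. cont_id \<in> asDual_dom S k a a \<and> asDual k a a cont_id = dual_id k a) \<and>
     (\<forall>a\<in>Dots k. \<forall>b\<in>Dots k. \<forall>c\<in>Dots k. \<forall>f\<in>asDual_dom S k a b. \<forall>g\<in>asDual_dom S k b c.
        cont_comp g f \<in> asDual_dom S k a c \<and>
        asDual k a c (cont_comp g f) = dual_comp k (asDual k b c g) (asDual k a b f)) \<and>
     (biproduct_category S k \<longrightarrow>
        \<comment> \<open>Monoidal\<close>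
        (\<forall>a\<in>Dots k. \<forall>b\<in>Dots k. \<forall>c\<in>Dots k. \<forall>d\<in>Dots k.
           \<forall>f\<in>asDual_dom S k a c. \<forall>g\<in>asDual_dom S k b d.
           cont_tensor S k c d f g \<in> asDual_dom S k (prod_space k a b) (prod_space k c d) \<and>
           asDual k (prod_space k a b) (prod_space k c d) (cont_tensor S k c d f g) =
             dual_tensor k (asDual k a c f) (asDual k b d g)) \<and>
        \<comment> \<open>Cartesian\<close>
        (\<forall>a\<in>Dots k. \<forall>b\<in>Dots k.
           cont_exl S k a b \<in> asDual_dom S k (prod_space k a b) a \<and>
           asDual k (prod_space k a b) a (cont_exl S k a b) = dual_exl k a b) \<and>
        (\<forall>a\<in>Dots k. \<forall>b\<in>Dots k.
           cont_exr S k a b \<in> asDual_dom S k (prod_space k a b) b \<and>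
           asDual k (prod_space k a b) b (cont_exr S k a b) = dual_exr k a b) \<and>
        (\<forall>a\<in>Dots k.
           cont_dup S k a \<in> asDual_dom S k a (prod_space k a a) \<and>
           asDual k a (prod_space k a a) (cont_dup S k a) = dual_dup k a) \<and>
        \<comment> \<open>Cocartesian\<close>
        (\<forall>a\<in>Dots k. \<forall>b\<in>Dots k.
           cont_inl k a b \<in> asDual_dom S k a (prod_space k a b) \<and>
           asDual k a (prod_space k a b) (cont_inl k a b) = dual_inl k a b) \<and>
        (\<forall>a\<in>Dots k. \<forall>b\<in>Dots k.
           cont_inr k a b \<in> asDual_dom S k b (prod_space k a b) \<and>
           asDual k b (prod_space k a b) (cont_inr k a b) = dual_inr k a b) \<and>
        (\<forall>a\<in>Dots k.
           cont_jam S k \<in> asDual_dom S k (prod_space k a a) a \<and>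
           asDual k (prod_space k a a) a (cont_jam S k) = dual_jam k a)) \<and>
     \<comment> \<open>Scalable\<close>
     (scalable_category S k \<longrightarrow>
        (\<forall>c\<in>carrier S. \<forall>a\<in>Dots k.
           cont_scale S k c \<in> asDual_dom S k a a \<and>
           asDual k a a (cont_scale S k c) = dual_scale k c a))"
proof -
  interpret dot_category S k by fact
  have bip: "dot_biproduct_category S k" if "biproduct_category S k"
    using assms that by (simp add: dot_biproduct_category_def)
  \<comment> \<open>Through \<open>bip\<close> the biproduct laws become implications from
    \<open>biproduct_category S k\<close>, the premise that \<open>impI\<close> makes available in
    those goals.\<close>
  note laws =
    asDual_cont_id asDual_cont_comp asDual_cont_scale
    dot_biproduct_category.asDual_cont_tensor[OF bip]
    dot_biproduct_category.asDual_cont_exl[OF bip] dot_biproduct_category.asDual_cont_exr[OF bip]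
    dot_biproduct_category.asDual_cont_dup[OF bip] dot_biproduct_category.asDual_cont_inl[OF bip]
    dot_biproduct_category.asDual_cont_inr[OF bip] dot_biproduct_category.asDual_cont_jam[OF bip]
  show ?thesis
    by (intro conjI ballI impI)
      (blast intro: asDual_closed laws[THEN conjunct1] laws[THEN conjunct2])+
qed

end
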